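(* For integers $m,n\ge 0$ let $f(m,n)$ denote the number of partitions of $n$ into exactly $m$ parts such that: no part appears more than twice; any two distinct part sizes that occur differ by at least $2$; and any two distinct part sizes that each occur twice (repeated part sizes) differ by at least $3$. Then, as formal power series in $x$ and $q$, $$\sum_{m,n\ge 0} f(m,n)\,x^m q^n=\sum_{m,n\ge 0}\frac{q^{6\binom{m+1}{2}+2\binom{n+1}{2}+2mn-4m-n}\,x^{2m+n}}{(q^2;q^2)_m\,(q;q)_n}.$$
   Context: For a variable $a$ and an integer $k\ge 0$, $(a;q)_k=\prod_{j=1}^{k}(1-aq^{j-1})$ (so $(a;q)_0=1$). A partition of $n$ is an unordered sum of positive integers adding up to $n$; the empty partition is the unique partition of $0$, with $0$ parts. *)

theory Defs
  imports
    "HOL-Analysis.Infinite_Sum"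
    "HOL-Computational_Algebra.Formal_Power_Series"
    "HOL-Library.Multiset"
begin

definition q_pochhammer :: "'a :: comm_ring_1 \<Rightarrow> 'a \<Rightarrow> nat \<Rightarrow> 'a" where
  "q_pochhammer a q k = (\<Prod>j=1..k. 1 - a * q ^ (j - 1))"

definition is_partition :: "nat \<Rightarrow> nat multiset \<Rightarrow> bool" where
  "is_partition n P \<longleftrightarrow> (\<forall>a\<in>#P. a > 0) \<and> sum_mset P = n"

definition admissible :: "nat multiset \<Rightarrow> bool" where
  "admissible P \<longleftrightarrow>
     (\<forall>a. count P a \<le> 2) \<and>
     (\<forall>a\<in>#P. \<forall>b\<in>#P. a < b \<longrightarrow> b - a \<ge> 2) \<and>
     (\<forall>a\<in>#P. \<forall>b\<in>#P. count P a = 2 \<longrightarrow> count P b = 2 \<longrightarrow> a < b \<longrightarrow> b - a \<ge> 3)"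

definition num_admissible :: "nat \<Rightarrow> nat \<Rightarrow> nat" where
  "num_admissible m n = card {P. is_partition n P \<and> size P = m \<and> admissible P}"

text \<open>The set counted by \<^const>\<open>num_admissible\<close> is finite, so \<^const>\<open>card\<close> is its true cardinality.\<close>

lemma finite_partitions: "finite {P. is_partition n P \<and> size P = m \<and> admissible P}"
proof (rule finite_subset)
  show "{P. is_partition n P \<and> size P = m \<and> admissible P} \<subseteq> mset ` {xs. set xs \<subseteq> {..n} \<and> length xs = m}"
  proof
    fix P assume P: "P \<in> {P. is_partition n P \<and> size P = m \<and> admissible P}"
    obtain xs where xs: "P = mset xs" by (metis ex_mset)
    have "a \<le> n" if "a \<in> set xs" for a
      using P that member_le_sum_list[of a xs]
      by (auto simp: xs is_partition_def sum_mset_sum_list)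
    then show "P \<in> mset ` {xs. set xs \<subseteq> {..n} \<and> length xs = m}"
      using P by (auto simp: xs)
  qed
  show "finite (mset ` {xs. set xs \<subseteq> {..n} \<and> length xs = m})"
    by (intro finite_imageI finite_lists_length_eq) auto
qed

definition q_exponent :: "nat \<Rightarrow> nat \<Rightarrow> nat" where
  "q_exponent m n = 6 * ((m + 1) choose 2) + 2 * ((n + 1) choose 2) + 2 * m * n - 4 * m - n"

text \<open>The subtractions in \<^const>\<open>q_exponent\<close> never truncate.\<close>

lemma int_q_exponent:
  "int (q_exponent m n) =
     6 * int ((m + 1) choose 2) + 2 * int ((n + 1) choose 2) + 2 * int m * int n - 4 * int m - int n"
proof -
  have c: "k \<le> (k + 1) choose 2" for k
    by (induction k) (auto simp: numeral_2_eq_2)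
  have "4 * m + n \<le> 6 * ((m + 1) choose 2) + 2 * ((n + 1) choose 2) + 2 * m * n"
    using c[of m] c[of n] by linarith
  then show ?thesis
    by (simp add: q_exponent_def of_nat_diff)
qed

text \<open>
  Power series in \<open>x\<close> and \<open>q\<close> are elements of \<open>rat fps fps\<close>: the outer variable is
  \<open>x\<close>, the inner one (the indeterminate of the coefficient ring) is \<open>q\<close>.
  The library topology on this type is the \<open>x\<close>-adic one, so \<open>has_sum\<close> on it means that
  each coefficient of a power of \<open>x\<close> is eventually constant along the finite partial sums.
\<close>

definition var_q :: "rat fps" where
  "var_q = fps_X"

definition var_x :: "rat fps fps" where
  "var_x = fps_X"

definition partition_series :: "rat fps fps" where
  "partition_series = Abs_fps (\<lambda>m. Abs_fps (\<lambda>n. of_nat (num_admissible m n)))"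

end

theory Submission
  imports Defs
begin

text \<open>
  The identity holds termwise: the summand for \<open>(m, n)\<close> is the generating function \<open>G(m, n)\<close>, in
  \<open>q\<close>, of the admissible partitions with exactly \<open>m\<close> repeated and \<open>n\<close> unrepeated part sizes.
  Split these partitions by the multiplicity \<open>c\<close> of the part \<open>1\<close>. If \<open>c = 0\<close>, lower every part by
  \<open>1\<close>; if \<open>c > 0\<close>, the part \<open>2\<close> is absent, so delete the ones and lower the rest by \<open>2\<close>, where for
  \<open>c = 2\<close> the result may not contain \<open>1\<close> twice. Hence, with \<open>U(m, n)\<close> and \<open>V(m, n)\<close> for \<open>c = 1, 2\<close>,

  \<open>G(m, n) = q^(2 m + n) G(m, n) + U(m, n) + V(m, n)\<close>,

  \<open>U(m, n + 1) = q^(4 m + 2 n + 1) G(m, n)\<close>,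

  \<open>V(m + 1, n) = q^(4 m + 2 n + 2) (q^(2 m + n) G(m, n) + U(m, n))\<close>.

  By induction, with \<open>E = q_exponent m n\<close> and up to the common denominator, \<open>U = q^(E + 2 m) (1 - q^n)\<close>
  and \<open>V = q^E (1 - q^(2 m))\<close>, which add up to \<open>q^E (1 - q^(2 m + n))\<close>.
\<close>

unbundle fps_syntax

section \<open>Partitions graded by their repeated and unrepeated part sizes\<close>

abbreviation shift :: "nat \<Rightarrow> nat multiset \<Rightarrow> nat multiset" where
  "shift k P \<equiv> image_mset ((+) k) P"

text \<open>For \<open>j = 2\<close> and \<open>j = 1\<close> these become the summation indices
  \<open>m\<close> and \<open>n\<close>. On natural numbers \<open>j = 0\<close> is degenerate: the
  set is infinite and \<open>card\<close> returns 0.\<close>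

definition multiplicity_card :: "nat \<Rightarrow> 'a multiset \<Rightarrow> nat" where
  "multiplicity_card j P = card {a. count P a = j}"

definition adm_set :: "nat \<Rightarrow> nat \<Rightarrow> nat multiset set" where
  "adm_set m n = {P. (\<forall>a\<in>#P. 0 < a) \<and> admissible P \<and>
     multiplicity_card 2 P = m \<and> multiplicity_card 1 P = n}"

text \<open>Since \<open>card\<close> is 0 on infinite sets, this is a genuine generating function
  only where each sum is attained finitely often. Subsets of a single \<open>adm_set m n\<close>
  have this property by \<open>finite_weight\<close>.\<close>

definition weight_series :: "nat multiset set \<Rightarrow> rat fps" where
  "weight_series A = Abs_fps (\<lambda>N. of_nat (card {P \<in> A. sum_mset P = N}))"

text \<open>A gap of at least 2 excludes exactly the difference 1; after that, the condition on
  repeated sizes excludes only the difference 2. In terms of \<open>count\<close> both conditions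
  are easy to transport along shifts.\<close>

lemma admissible_iff_count:
  "admissible P \<longleftrightarrow> (\<forall>a. count P a \<le> 2) \<and>
     (\<forall>a. count P a = 0 \<or> count P (Suc a) = 0) \<and>
     (\<forall>a. count P a = 2 \<longrightarrow> count P (a + 2) \<noteq> 2)" (is "_ \<longleftrightarrow> ?R")
proof
  assume A: "admissible P"
  have "count P a = 0 \<or> count P (Suc a) = 0" for a
  proof (rule ccontr)
    assume "\<not> ?thesis"
    hence "a \<in># P" "Suc a \<in># P" by (auto simp flip: count_greater_zero_iff)
    with A have "Suc a - a \<ge> 2" unfolding admissible_def by blast
    thus False by simp
  qed
  moreover have "count P (a + 2) \<noteq> 2" if "count P a = 2" for a
  proof
    assume "count P (a + 2) = 2"
    moreover from this that have "a \<in># P" "a + 2 \<in># P" by (auto simp flip: count_greater_zero_iff)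
    ultimately have "a + 2 - a \<ge> 3" using A that unfolding admissible_def
      by (metis less_add_same_cancel1 zero_less_numeral)
    thus False by simp
  qed
  ultimately show ?R using A unfolding admissible_def by blast
next
  assume R: ?R
  have two: "b - a \<ge> 2" if "a \<in># P" "b \<in># P" "a < b" for a b
  proof (rule ccontr)
    assume "\<not> ?thesis"
    hence "b = Suc a" using that by linarith
    thus False using R that by (metis not_in_iff)
  qed
  have three: "b - a \<ge> 3" if "a \<in># P" "b \<in># P" "count P a = 2" "count P b = 2" "a < b" for a b
  proof (rule ccontr)
    assume "\<not> ?thesis"
    hence "b = a + 2" using that two[of a b] by linarith
    thus False using R that by metis
  qed
  show "admissible P" unfolding admissible_def using R two three by blast
qed

section \<open>Shifting all parts and adjoining ones\<close>

lemma count_shift: "count (shift k P) a = (if a < k then 0 else count P (a - k))"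
  by (induction P) auto

lemma sum_mset_shift: "sum_mset (shift k P) = k * size P + sum_mset P"
  by (induction P) auto

lemma admissible_shift: "admissible (shift k P) \<longleftrightarrow> admissible P"
proof
  assume A: "admissible (shift k P)"
  have c: "count P a = count (shift k P) (k + a)" for a by (simp add: count_shift)
  show "admissible P"
    using A unfolding admissible_iff_count c by (metis add.assoc add_Suc_right)
next
  assume "admissible P"
  thus "admissible (shift k P)"
    unfolding admissible_iff_count count_shift by (auto simp: Suc_diff_le)
qed

lemma multiplicity_card_shift:
  assumes "j > 0"
  shows "multiplicity_card j (shift k P) = multiplicity_card j P"
proof -
  have "{a. count (shift k P) a = j} = (+) k ` {a. count P a = j}"
  proof (intro equalityI subsetI)
    fix a assume "a \<in> {a. count (shift k P) a = j}"
    with assms show "a \<in> (+) k ` {a. count P a = j}"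
      by (intro image_eqI[of _ _ "a - k"]) (auto simp: count_shift split: if_splits)
  qed (auto simp: count_shift)
  thus ?thesis by (simp add: multiplicity_card_def card_image)
qed

text \<open>The truncated subtraction \<open>a - k\<close> is exact because every part exceeds
  \<open>k\<close>.\<close>

lemma shift_surj:
  assumes "\<forall>a\<in>#P. k < a"
  obtains Q where "\<forall>a\<in>#Q. 0 < a" "P = shift k Q"
proof
  show "\<forall>a\<in>#image_mset (\<lambda>a. a - k) P. 0 < a" using assms by auto
  have "image_mset (\<lambda>a. k + (a - k)) P = image_mset id P"
    by (rule image_mset_cong) (use assms in auto)
  thus "P = shift k (image_mset (\<lambda>a. a - k) P)"
    by (simp add: multiset.map_comp comp_def)
qed

text \<open>All of \<open>R\<close> lies above 2, so the ones are never adjacent to a part of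
  \<open>R\<close>, and the only pair at difference 2 that can involve 1 is 1 and 3.\<close>

lemma admissible_replicate_add:
  assumes "\<forall>a\<in>#R. 2 < a"
  shows "admissible (replicate_mset c 1 + R) \<longleftrightarrow>
    c \<le> 2 \<and> admissible R \<and> \<not> (c = 2 \<and> count R 3 = 2)" (is "?L \<longleftrightarrow> ?R")
proof -
  have R0: "count R a = 0" if "a \<le> 2" for a
    using assms that by (auto simp: count_eq_zero_iff)
  have cnt: "count (replicate_mset c 1 + R) a = (if a = 1 then c else count R a)" for a
    using R0[of 1] by auto
  show ?thesis
  proof
    assume L: ?L
    have "c \<le> 2" using L cnt[of 1] unfolding admissible_iff_count by metis
    moreover have "\<not> (c = 2 \<and> count R 3 = 2)"
    proof
      assume "c = 2 \<and> count R 3 = 2"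
      moreover have "(1 :: nat) + 2 = 3" by simp
      ultimately show False
        using L cnt[of 1] cnt[of 3] unfolding admissible_iff_count
        by (metis numeral_eq_one_iff semiring_norm(86))
    qed
    moreover have "admissible R"
      unfolding admissible_iff_count
    proof (intro conjI allI impI)
      fix a
      have le: "count (replicate_mset c 1 + R) a \<le> 2"
        and gap: "count (replicate_mset c 1 + R) a = 0 \<or> count (replicate_mset c 1 + R) (Suc a) = 0"
        and gap2: "count (replicate_mset c 1 + R) a = 2 \<longrightarrow> count (replicate_mset c 1 + R) (a + 2) \<noteq> 2"
        using iffD1[OF admissible_iff_count L] by simp_all
      show "count R a \<le> 2" using le by simp
      show "count R a = 0 \<or> count R (Suc a) = 0" using gap by auto
      show "count R (a + 2) \<noteq> 2" if "count R a = 2"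
      proof -
        \<comment> \<open>Thus neither \<open>a\<close> nor \<open>a + 2\<close> is 1, and both
          counts are those of \<open>R\<close>.\<close>
        have "a > 2" using that R0[of a] by fastforce
        thus ?thesis using gap2 that unfolding cnt by simp
      qed
    qed
    ultimately show ?R by blast
  next
    assume R: ?R
    show ?L
      unfolding admissible_iff_count cnt
    proof (intro conjI allI impI)
      fix a
      have le: "count R a \<le> 2" and gap: "count R a = 0 \<or> count R (Suc a) = 0"
        and gap2: "count R a = 2 \<longrightarrow> count R (a + 2) \<noteq> 2"
        using R iffD1[OF admissible_iff_count, of R] by simp_all
      show "(if a = 1 then c else count R a) \<le> 2" using R le by simp
      \<comment> \<open>The adjacent pairs that touch 1 are 0, 1 and 1, 2, and \<open>R\<close>
        contains neither 0 nor 2.\<close>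
      show "(if a = 1 then c else count R a) = 0 \<or> (if Suc a = 1 then c else count R (Suc a)) = 0"
        using R0[of 0] R0[of 2] gap by (auto simp: numeral_2_eq_2)
      show "(if a + 2 = 1 then c else count R (a + 2)) \<noteq> 2"
        if "(if a = 1 then c else count R a) = 2"
      proof (cases "a = 1")
        case True
        hence "a + 2 = 3" by simp
        thus ?thesis using R that True by (simp only: if_True) simp
      qed (use that gap2 in simp)
    qed
  qed
qed

lemma finite_multiplicity_card: "j > 0 \<Longrightarrow> finite {a. count P a = j}"
  by (rule finite_subset[of _ "set_mset P"]) (auto simp flip: count_greater_zero_iff)

lemma multiplicity_card_replicate_add:
  assumes "count R x = 0" "j > 0"
  shows "multiplicity_card j (replicate_mset c x + R) =
    multiplicity_card j R + (if c = j then 1 else 0)"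
proof -
  have "{a. count (replicate_mset c x + R) a = j} = (if c = j then insert x else id) {a. count R a = j}"
    using assms by auto
  thus ?thesis using assms by (auto simp: multiplicity_card_def finite_multiplicity_card)
qed

text \<open>Every part has multiplicity 1 or 2, so the shape \<open>(m, n)\<close> fixes the
  exponent of \<open>x\<close>.\<close>

lemma size_admissible:
  assumes "admissible P"
  shows "size P = 2 * multiplicity_card 2 P + multiplicity_card 1 P"
proof -
  have "set_mset P = {a. count P a = 2} \<union> {a. count P a = 1}"
  proof (intro equalityI subsetI)
    fix a assume "a \<in># P"
    hence "count P a \<noteq> 0" "count P a \<le> 2" using assms by (auto simp: admissible_def)
    hence "count P a = 2 \<or> count P a = 1" by linarith
    thus "a \<in> {a. count P a = 2} \<union> {a. count P a = 1}" by blast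
  qed (auto simp flip: count_greater_zero_iff)
  hence "size P = (\<Sum>a\<in>{a. count P a = 2} \<union> {a. count P a = 1}. count P a)"
    by (simp add: size_multiset_overloaded_eq)
  also have "\<dots> = (\<Sum>a | count P a = 2. count P a) + (\<Sum>a | count P a = 1. count P a)"
    by (rule sum.union_disjoint) (auto intro: finite_multiplicity_card)
  finally show ?thesis by (simp add: multiplicity_card_def)
qed

section \<open>Rules for generating functions by weight\<close>

lemma finite_weight:
  assumes "A \<subseteq> adm_set m n"
  shows "finite {P \<in> A. sum_mset P = N}"
proof (rule finite_subset[OF _ finite_partitions[of N "2 * m + n"]])
  show "{P \<in> A. sum_mset P = N} \<subseteq> {P. is_partition N P \<and> size P = 2 * m + n \<and> admissible P}"
    using assms by (auto simp: adm_set_def is_partition_def size_admissible)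
qed

lemma weight_series_union:
  assumes "A \<subseteq> adm_set m n" "B \<subseteq> adm_set m n" "A \<inter> B = {}"
  shows "weight_series (A \<union> B) = weight_series A + weight_series B"
proof (rule fps_ext)
  fix N
  have "{P \<in> A \<union> B. sum_mset P = N} = {P \<in> A. sum_mset P = N} \<union> {P \<in> B. sum_mset P = N}"
    by auto
  moreover have "card \<dots> = card {P \<in> A. sum_mset P = N} + card {P \<in> B. sum_mset P = N}"
    by (rule card_Un_disjoint) (use assms in \<open>auto intro: finite_weight\<close>)
  ultimately show "weight_series (A \<union> B) $ N = (weight_series A + weight_series B) $ N"
    by (simp add: weight_series_def)
qed

lemma weight_series_image:
  assumes "inj_on f A" "\<And>P. P \<in> A \<Longrightarrow> sum_mset (f P) = c + sum_mset P"
  shows "weight_series (f ` A) = var_q ^ c * weight_series A"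
proof (rule fps_ext)
  fix N
  have eq: "{P \<in> f ` A. sum_mset P = N} = f ` {P \<in> A. c + sum_mset P = N}"
    using assms(2) by auto
  have "card {P \<in> f ` A. sum_mset P = N} = card {P \<in> A. c + sum_mset P = N}"
    unfolding eq by (rule card_image) (rule inj_on_subset[OF assms(1)], auto)
  also have "{P \<in> A. c + sum_mset P = N} = (if N < c then {} else {P \<in> A. sum_mset P = N - c})"
    by auto
  finally show "weight_series (f ` A) $ N = (var_q ^ c * weight_series A) $ N"
    by (simp add: weight_series_def var_q_def fps_X_power_mult_nth)
qed

section \<open>Splitting by the multiplicity of the part 1, and the recurrences\<close>

lemma inj_shift: "inj (shift k)"
  by (rule multiset.inj_map) simp

lemma inj_replicate_shift: "inj (\<lambda>P. replicate_mset c x + shift k P)"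
  by (rule injI) (auto dest: injD[OF inj_shift])

text \<open>The shift by 2 turns parts 1 of \<open>Q\<close> into parts 3, so the forbidden pair of
  repeated sizes 1 and 3 becomes a condition on \<open>count Q 1\<close>. The conditional summands
  record whether the new size 1 is repeated, so that one statement covers both
  multiplicities.\<close>

lemma replicate_shift_mem_adm_set:
  assumes "\<forall>a\<in>#Q. 0 < a" "c = 1 \<or> c = 2"
  shows "replicate_mset c 1 + shift 2 Q \<in>
           adm_set (m + (if c = 2 then 1 else 0)) (n + (if c = 1 then 1 else 0)) \<longleftrightarrow>
         Q \<in> adm_set m n \<and> \<not> (c = 2 \<and> count Q 1 = 2)"
proof -
  have R: "\<forall>a\<in>#shift 2 Q. 2 < a" "count (shift 2 Q) 1 = 0" "count (shift 2 Q) 3 = count Q 1"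
    using assms by (auto simp: count_shift)
  have pos: "\<forall>a\<in>#replicate_mset c 1 + shift 2 Q. 0 < a" by auto
  show ?thesis
    unfolding adm_set_def mem_Collect_eq admissible_replicate_add[OF R(1)]
      multiplicity_card_replicate_add[OF R(2) zero_less_numeral]
      multiplicity_card_replicate_add[OF R(2) zero_less_one] admissible_shift R(3)
      multiplicity_card_shift[OF zero_less_numeral] multiplicity_card_shift[OF zero_less_one]
    using assms pos by auto
qed

lemma first_part_decompose:
  assumes "P \<in> adm_set m n" "count P 1 > 0"
  obtains Q where "\<forall>a\<in>#Q. 0 < a" "P = replicate_mset (count P 1) 1 + shift 2 Q"
proof -
  define R where "R = filter_mset (\<lambda>a. a \<noteq> 1) P"
  have P: "P = replicate_mset (count P 1) 1 + R"
    by (rule multiset_eqI) (simp add: R_def)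
  have "count P 2 = 0"
    using assms unfolding adm_set_def admissible_iff_count mem_Collect_eq
    by (metis Suc_1 One_nat_def less_numeral_extra(3))
  have "2 < a" if "a \<in># R" for a
  proof -
    have "a \<in># P" "a \<noteq> 1" using that by (auto simp: R_def)
    moreover have "a \<noteq> 2" using \<open>count P 2 = 0\<close> \<open>a \<in># P\<close> by (metis not_in_iff)
    moreover have "0 < a" using assms(1) \<open>a \<in># P\<close> by (auto simp: adm_set_def)
    ultimately show ?thesis by linarith
  qed
  with shift_surj[of R 2] obtain Q where "\<forall>a\<in>#Q. 0 < a" "R = shift 2 Q" by blast
  with P that show ?thesis by metis
qed

lemma first_part_eq_0:
  "{P \<in> adm_set m n. count P 1 = 0} = shift 1 ` adm_set m n" (is "?L = ?R")
proof (intro equalityI subsetI)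
  fix P assume P: "P \<in> ?L"
  have "1 < a" if "a \<in># P" for a
  proof -
    have "0 < a" using P that by (auto simp: adm_set_def)
    moreover have "a \<noteq> 1" using P that by (metis (mono_tags, lifting) mem_Collect_eq not_in_iff)
    ultimately show ?thesis by linarith
  qed
  then obtain Q where Q: "\<forall>a\<in>#Q. 0 < a" "P = shift 1 Q"
    using shift_surj[of P 1] by blast
  moreover from Q P have "Q \<in> adm_set m n"
    by (simp add: adm_set_def admissible_shift multiplicity_card_shift)
  ultimately show "P \<in> ?R" by blast
next
  fix P assume "P \<in> ?R"
  thus "P \<in> ?L"
    by (auto simp: adm_set_def admissible_shift multiplicity_card_shift count_shift count_eq_zero_iff)
qed

lemma first_part_pos:
  assumes "c = 1 \<or> c = 2"
  shows "{P \<in> adm_set (m + (if c = 2 then 1 else 0)) (n + (if c = 1 then 1 else 0)). count P 1 = c} =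
    (\<lambda>Q. replicate_mset c 1 + shift 2 Q) ` {Q \<in> adm_set m n. \<not> (c = 2 \<and> count Q 1 = 2)}"
  (is "?L = ?f ` ?R")
proof (intro equalityI subsetI)
  fix P assume P: "P \<in> ?L"
  moreover from P assms have "count P 1 > 0" by auto
  ultimately obtain Q where Q: "\<forall>a\<in>#Q. 0 < a" "P = ?f Q"
    by (auto elim: first_part_decompose)
  with P replicate_shift_mem_adm_set[OF Q(1) assms] have "Q \<in> ?R" by simp
  with Q show "P \<in> ?f ` ?R" by blast
next
  fix P assume "P \<in> ?f ` ?R"
  then obtain Q where Q: "P = ?f Q" "Q \<in> ?R" by blast
  moreover from Q have "\<forall>a\<in>#Q. 0 < a" by (simp add: adm_set_def)
  ultimately show "P \<in> ?L"
    using replicate_shift_mem_adm_set[OF _ assms] by (simp add: count_shift)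
qed

text \<open>For \<open>c = 1\<close> and \<open>c = 2\<close> these are \<open>U(m, n)\<close> and
  \<open>V(m, n)\<close>; \<open>c = 0\<close> gives the term of the recurrence that contains
  \<open>G(m, n)\<close> itself.\<close>

abbreviation first_part_series :: "nat \<Rightarrow> nat \<Rightarrow> nat \<Rightarrow> rat fps" where
  "first_part_series c m n \<equiv> weight_series {P \<in> adm_set m n. count P 1 = c}"

lemma size_adm_set: "P \<in> adm_set m n \<Longrightarrow> size P = 2 * m + n"
  by (simp add: adm_set_def size_admissible)

lemma first_part_series_0:
  "first_part_series 0 m n = var_q ^ (2 * m + n) * weight_series (adm_set m n)"
  unfolding first_part_eq_0
proof (rule weight_series_image)
  show "inj_on (shift 1) (adm_set m n)"
    by (rule inj_on_subset[OF inj_shift]) simp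
qed (simp add: sum_mset_shift size_adm_set)

text \<open>The ones contribute \<open>c\<close>, and each of the \<open>2 * m + n\<close> parts
  rises by 2.\<close>

lemma weight_series_replicate_shift:
  assumes "A \<subseteq> adm_set m n"
  shows "weight_series ((\<lambda>Q. replicate_mset c 1 + shift 2 Q) ` A) =
    var_q ^ (c + 2 * (2 * m + n)) * weight_series A"
proof (rule weight_series_image)
  show "inj_on (\<lambda>Q. replicate_mset c 1 + shift 2 Q) A"
    by (rule inj_on_subset[OF inj_replicate_shift]) simp
  show "sum_mset (replicate_mset c 1 + shift 2 P) = c + 2 * (2 * m + n) + sum_mset P" if "P \<in> A" for P
    using that assms size_adm_set[of P m n] by (auto simp: sum_mset_shift)
qed

lemma first_part_series_1_Suc:
  "first_part_series 1 m (Suc n) = var_q ^ (4 * m + 2 * n + 1) * weight_series (adm_set m n)"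
proof -
  have "{P \<in> adm_set m (Suc n). count P 1 = 1} =
      (\<lambda>Q. replicate_mset 1 1 + shift 2 Q) ` adm_set m n"
    using first_part_pos[of 1 m n] by simp
  moreover have "1 + 2 * (2 * m + n) = 4 * m + 2 * n + 1" by simp
  ultimately show ?thesis by (simp only: weight_series_replicate_shift[OF order.refl])
qed

text \<open>Admissibility bounds the multiplicity of 1 by 2, so the classes are exhaustive. The
  second equation describes what may remain once two ones have been deleted and the rest
  lowered.\<close>

lemma weight_series_split:
  "weight_series (adm_set m n) =
     first_part_series 0 m n + first_part_series 1 m n + first_part_series 2 m n"
  "weight_series {P \<in> adm_set m n. count P 1 \<noteq> 2} =
     first_part_series 0 m n + first_part_series 1 m n"
proof -
  have "count P 1 \<le> 2" if "P \<in> adm_set m n" for P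
    using that by (auto simp: adm_set_def admissible_def)
  hence eq: "count P 1 = 0 \<or> count P 1 = 1 \<or> count P 1 = 2" if "P \<in> adm_set m n" for P
    using that by (metis One_nat_def Suc_1 le_SucE le_zero_eq)
  have "{P \<in> adm_set m n. count P 1 \<noteq> 2} =
      {P \<in> adm_set m n. count P 1 = 0} \<union> {P \<in> adm_set m n. count P 1 = 1}"
    using eq by fastforce
  also have "weight_series \<dots> = first_part_series 0 m n + first_part_series 1 m n"
    by (rule weight_series_union) auto
  finally show le1: "weight_series {P \<in> adm_set m n. count P 1 \<noteq> 2} = \<dots>" .
  have "weight_series ({P \<in> adm_set m n. count P 1 \<noteq> 2} \<union> {P \<in> adm_set m n. count P 1 = 2}) =
      weight_series {P \<in> adm_set m n. count P 1 \<noteq> 2} + first_part_series 2 m n"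
    by (rule weight_series_union) auto
  moreover have "{P \<in> adm_set m n. count P 1 \<noteq> 2} \<union> {P \<in> adm_set m n. count P 1 = 2} = adm_set m n"
    by blast
  ultimately show "weight_series (adm_set m n) =
      first_part_series 0 m n + first_part_series 1 m n + first_part_series 2 m n"
    unfolding le1 by (simp only:)
qed

lemma first_part_series_2_Suc:
  "first_part_series 2 (Suc m) n = var_q ^ (4 * m + 2 * n + 2) *
     (first_part_series 0 m n + first_part_series 1 m n)"
proof -
  have "{P \<in> adm_set (Suc m) n. count P 1 = 2} =
      (\<lambda>Q. replicate_mset 2 1 + shift 2 Q) ` {Q \<in> adm_set m n. count Q 1 \<noteq> 2}"
    using first_part_pos[of 2 m n] by simp
  moreover have "2 + 2 * (2 * m + n) = 4 * m + 2 * n + 2" by simp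
  moreover have "{Q \<in> adm_set m n. count Q 1 \<noteq> 2} \<subseteq> adm_set m n" by blast
  ultimately show ?thesis by (simp only: weight_series_replicate_shift weight_series_split(2))
qed

lemma weight_series_empty [simp]: "weight_series {} = 0"
  by (rule fps_ext) (simp add: weight_series_def)

text \<open>A part 1 of multiplicity \<open>j\<close> makes \<open>multiplicity_card j\<close>
  positive. These are the boundary values for the recurrences, which start at a successor.\<close>

lemma first_part_series_degenerate:
  "first_part_series 1 m 0 = 0" "first_part_series 2 0 n = 0"
proof -
  have "multiplicity_card (count P 1) P \<noteq> 0" if "count P 1 > 0" for P :: "nat multiset"
    using finite_multiplicity_card[OF that, of P] by (auto simp: multiplicity_card_def card_eq_0_iff)
  hence "P \<in> adm_set m 0 \<Longrightarrow> count P 1 \<noteq> 1" "P \<in> adm_set 0 n \<Longrightarrow> count P 1 \<noteq> 2" for P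
    unfolding adm_set_def mem_Collect_eq by (metis zero_less_one, metis zero_less_numeral)
  hence "{P \<in> adm_set m 0. count P 1 = 1} = {}" "{P \<in> adm_set 0 n. count P 1 = 2} = {}"
    by blast+
  thus "first_part_series 1 m 0 = 0" "first_part_series 2 0 n = 0"
    by (simp_all only: weight_series_empty)
qed

lemma weight_series_adm_set_0_0: "weight_series (adm_set 0 0) = 1"
proof -
  have "P = {#}" if "P \<in> adm_set 0 0" for P
    using size_adm_set[OF that] by simp
  moreover have "{#} \<in> adm_set 0 0"
    by (simp add: adm_set_def admissible_def multiplicity_card_def)
  ultimately have "adm_set 0 0 = {{#}}" by blast
  hence "{P \<in> adm_set 0 0. sum_mset P = N} = (if N = 0 then {{#}} else {})" for N by auto
  thus ?thesis by (intro fps_ext) (simp add: weight_series_def)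
qed

section \<open>Solving the recurrences in closed form\<close>

lemma q_pochhammer_Suc: "q_pochhammer a q (Suc k) = q_pochhammer a q k * (1 - a * q ^ k)"
  by (simp add: q_pochhammer_def)

text \<open>Each factor has constant coefficient 1, because a positive power of \<open>var_q\<close>
  has constant coefficient 0.\<close>

lemma q_pochhammer_var_q_nonzero:
  assumes "j > 0"
  shows "q_pochhammer (var_q ^ j) (var_q ^ j) k \<noteq> 0"
proof -
  have "q_pochhammer (var_q ^ j) (var_q ^ j) k $ 0 = 1" for k
    using assms
    by (induction k) (simp_all add: q_pochhammer_Suc q_pochhammer_def[of _ _ 0] var_q_def power_0_left)
  thus ?thesis by (metis fps_zero_nth zero_neq_one)
qed

text \<open>The exponent is the quadratic polynomial \<open>3 * m^2 - m + n^2 + 2 * m * n\<close>;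
  moving \<open>m\<close> to the left keeps the equation free of subtraction on natural
  numbers.\<close>

lemma q_exponent_eq: "q_exponent m n + m = 3 * m\<^sup>2 + n\<^sup>2 + 2 * m * n"
proof -
  have c: "2 * ((k + 1) choose 2) = k * k + k" for k :: nat
    by (induction k) (auto simp: numeral_2_eq_2)
  have "int (q_exponent m n) + int m = 3 * int m ^ 2 + int n ^ 2 + 2 * int m * int n"
    using c[of m, THEN arg_cong[of _ _ int]] c[of n, THEN arg_cong[of _ _ int]]
    unfolding int_q_exponent by (simp add: power2_eq_square algebra_simps)
  hence "int (q_exponent m n + m) = int (3 * m\<^sup>2 + n\<^sup>2 + 2 * m * n)" by simp
  thus ?thesis by (simp only: of_nat_eq_iff)
qed

text \<open>Clearing denominators lets the recurrences be used by ring arithmetic. The induction is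
  on \<open>m + n\<close> because \<open>V(m, n)\<close> leads back to \<open>(m - 1, n)\<close>
  and, through \<open>U\<close>, to \<open>(m - 1, n - 1)\<close>.\<close>

lemma weight_series_times_pochhammer:
  "weight_series (adm_set m n) *
     (q_pochhammer (var_q ^ 2) (var_q ^ 2) m * q_pochhammer var_q var_q n) = var_q ^ q_exponent m n"
proof (induction "m + n" arbitrary: m n rule: less_induct)
  case less
  let ?G = "\<lambda>m n. weight_series (adm_set m n)"
  let ?D = "\<lambda>m n. q_pochhammer (var_q ^ 2) (var_q ^ 2) m * q_pochhammer var_q var_q n"
  \<comment> \<open>Stated for arbitrary indices, with the induction hypothesis as a premise, since
    it is applied at \<open>(m, n)\<close> and, inside \<open>V\<close>, at
    \<open>(m - 1, n)\<close>.\<close>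
  have U: "first_part_series 1 m n * ?D m n = var_q ^ (q_exponent m n + 2 * m) * (1 - var_q ^ n)"
    if "\<And>k. n = Suc k \<Longrightarrow> ?G m k * ?D m k = var_q ^ q_exponent m k" for m n
  proof (cases n)
    case 0
    then show ?thesis by (simp only: first_part_series_degenerate) simp
  next
    case (Suc k)
    have "first_part_series 1 m n * ?D m n =
        var_q ^ (4 * m + 2 * k + 1) * (?G m k * ?D m k) * (1 - var_q ^ n)"
      unfolding Suc first_part_series_1_Suc q_pochhammer_Suc by (simp add: algebra_simps)
    also have "\<dots> = var_q ^ (4 * m + 2 * k + 1 + q_exponent m k) * (1 - var_q ^ n)"
      by (simp add: that[OF Suc] power_add)
    \<comment> \<open>Passing from \<open>k\<close> to \<open>k + 1\<close> in the second index
      raises the exponent by \<open>2 * m + 2 * k + 1\<close>.\<close>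
    also have "4 * m + 2 * k + 1 + q_exponent m k = q_exponent m n + 2 * m"
      using q_exponent_eq[of m k] q_exponent_eq[of m n]
      by (simp add: Suc power2_eq_square algebra_simps)
    finally show ?thesis .
  qed
  have V: "first_part_series 2 m n * ?D m n = var_q ^ q_exponent m n * (1 - var_q ^ (2 * m))"
  proof (cases m)
    case 0
    then show ?thesis by (simp only: first_part_series_degenerate) simp
  next
    case (Suc k)
    have IH: "?G k n * ?D k n = var_q ^ q_exponent k n" using less[of k n] Suc by simp
    have "first_part_series 1 k n * ?D k n = var_q ^ (q_exponent k n + 2 * k) * (1 - var_q ^ n)"
      by (rule U) (use less Suc in simp)
    moreover have "first_part_series 0 k n * ?D k n = var_q ^ (q_exponent k n + 2 * k) * var_q ^ n"
      unfolding first_part_series_0 mult.assoc IH by (simp add: ac_simps flip: power_add)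
    \<comment> \<open>The factors \<open>var_q ^ n\<close> and \<open>1 - var_q ^ n\<close> add up
      to 1.\<close>
    ultimately have sum: "(first_part_series 0 k n + first_part_series 1 k n) * ?D k n =
        var_q ^ (q_exponent k n + 2 * k)"
      by (simp add: algebra_simps)
    have "first_part_series 2 m n * ?D m n = var_q ^ (4 * k + 2 * n + 2) *
        ((first_part_series 0 k n + first_part_series 1 k n) * ?D k n) * (1 - var_q ^ (2 * m))"
      unfolding Suc first_part_series_2_Suc q_pochhammer_Suc
      by (simp add: mult_ac power_mult[symmetric] power_add[symmetric])
    also have "\<dots> = var_q ^ (4 * k + 2 * n + 2 + (q_exponent k n + 2 * k)) * (1 - var_q ^ (2 * m))"
      by (simp only: sum power_add)
    \<comment> \<open>Passing from \<open>k\<close> to \<open>k + 1\<close> in the first index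
      raises the exponent by \<open>6 * k + 2 * n + 2\<close>.\<close>
    also have "4 * k + 2 * n + 2 + (q_exponent k n + 2 * k) = q_exponent m n"
      using q_exponent_eq[of k n] q_exponent_eq[of m n]
      by (simp add: Suc power2_eq_square algebra_simps)
    finally show ?thesis .
  qed
  show ?case
  proof (cases "m + n = 0")
    case True
    then show ?thesis by (simp add: weight_series_adm_set_0_0 q_pochhammer_def q_exponent_def numeral_2_eq_2)
  next
    case False
    have U': "first_part_series 1 m n * ?D m n = var_q ^ (q_exponent m n + 2 * m) * (1 - var_q ^ n)"
      by (rule U) (use less in simp)
    \<comment> \<open>The class without ones is a multiple of \<open>G(m, n)\<close> itself and
      moves to the left-hand side.\<close>
    have "?G m n * (1 - var_q ^ (2 * m + n)) = first_part_series 1 m n + first_part_series 2 m n"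
      using weight_series_split(1)[of m n] unfolding first_part_series_0
      by (simp add: algebra_simps)
    hence "?G m n * (1 - var_q ^ (2 * m + n)) * ?D m n =
        (first_part_series 1 m n + first_part_series 2 m n) * ?D m n"
      by (rule arg_cong)
    also have "\<dots> = first_part_series 1 m n * ?D m n + first_part_series 2 m n * ?D m n"
      by (rule distrib_right)
    also have "\<dots> = var_q ^ q_exponent m n * (1 - var_q ^ (2 * m + n))"
      unfolding U' V by (simp add: algebra_simps power_add)
    finally have "?G m n * (1 - var_q ^ (2 * m + n)) * ?D m n =
        var_q ^ q_exponent m n * (1 - var_q ^ (2 * m + n))" .
    hence *: "?G m n * ?D m n * (1 - var_q ^ (2 * m + n)) =
        var_q ^ q_exponent m n * (1 - var_q ^ (2 * m + n))"
      by (simp only: mult_ac)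
    \<comment> \<open>At \<open>m = n = 0\<close> this factor vanishes, which is why that case is
      settled separately; otherwise it can be cancelled.\<close>
    have "(1 - var_q ^ (2 * m + n)) $ 0 = 1"
      using False by (simp add: var_q_def power_0_left)
    hence "1 - var_q ^ (2 * m + n) \<noteq> 0" by (metis fps_zero_nth zero_neq_one)
    with * show ?thesis by simp
  qed
qed

lemma weight_series_adm_set:
  "weight_series (adm_set m n) = var_q ^ q_exponent m n /
     (q_pochhammer (var_q ^ 2) (var_q ^ 2) m * q_pochhammer var_q var_q n)"
  using q_pochhammer_var_q_nonzero[of 2 m] q_pochhammer_var_q_nonzero[of 1 n]
  by (simp flip: weight_series_times_pochhammer)

section \<open>Summation over all shapes\<close>

lemma finite_shapes: "finite {(m, n). 2 * m + n = (k :: nat)}"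
  by (rule finite_subset[of _ "{..k} \<times> {..k}"]) auto

text \<open>Each admissible partition into \<open>k\<close> parts has exactly one shape, and its
  shape satisfies \<open>2 * m + n = k\<close>; the coefficient is therefore a finite disjoint
  sum.\<close>

lemma partition_series_nth:
  "partition_series $ k = (\<Sum>(m, n) | 2 * m + n = k. weight_series (adm_set m n))"
proof (rule fps_ext)
  fix N
  let ?I = "{(m, n). 2 * m + n = k}"
  have "{P. is_partition N P \<and> size P = k \<and> admissible P} =
      (\<Union>(m, n)\<in>?I. {P \<in> adm_set m n. sum_mset P = N})"
    by (auto simp: adm_set_def is_partition_def size_admissible)
  also have "card \<dots> = (\<Sum>(m, n)\<in>?I. card {P \<in> adm_set m n. sum_mset P = N})"
    unfolding split_def
  proof (rule card_UN_disjoint)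
    show "\<forall>p\<in>{p. 2 * fst p + snd p = k}. finite {P \<in> adm_set (fst p) (snd p). sum_mset P = N}"
      using finite_weight by blast
  qed (use finite_shapes[of k] in \<open>auto simp: split_def adm_set_def\<close>)
  finally show "partition_series $ k $ N = (\<Sum>(m, n)\<in>?I. weight_series (adm_set m n)) $ N"
    by (simp add: partition_series_def num_admissible_def fps_sum_nth weight_series_def split_def)
qed

theorem theorem1:
  shows "((\<lambda>(m, n).
            fps_const (var_q ^ q_exponent m n / (q_pochhammer (var_q ^ 2) (var_q ^ 2) m * q_pochhammer var_q var_q n))
              * var_x ^ (2 * m + n))
          has_sum partition_series) (UNIV :: (nat \<times> nat) set)"
  unfolding weight_series_adm_set[symmetric]
\<comment> \<open>Convergence is checked coefficientwise in \<open>x\<close>: each power of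
  \<open>x\<close> receives finitely many nonzero contributions, which must add up to the
  coefficient of the limit.\<close>
proof (rule has_sum_fpsI)
  let ?F = "\<lambda>(m, n). fps_const (weight_series (adm_set m n)) * var_x ^ (2 * m + n)"
  have nth: "?F p $ k = (if p \<in> {(m, n). 2 * m + n = k}
      then weight_series (case p of (m, n) \<Rightarrow> adm_set m n) else 0)" for p k
    by (auto simp: var_x_def split: prod.split)
  show "finite {p \<in> UNIV. ?F p $ k \<noteq> 0}" for k
    by (rule finite_subset[OF _ finite_shapes[of k]]) (auto simp: nth split: if_splits)
  show "partition_series $ k = (\<Sum>p | p \<in> UNIV \<and> ?F p $ k \<noteq> 0. ?F p $ k)" for k
  proof -
    have "partition_series $ k = (\<Sum>p | case p of (m, n) \<Rightarrow> 2 * m + n = k. ?F p $ k)"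
      unfolding partition_series_nth by (intro sum.cong) (auto simp: nth)
    \<comment> \<open>A nonzero contribution forces \<open>2 * m + n = k\<close>, and shapes with
      zero contribution leave the sum unchanged.\<close>
    also have "\<dots> = (\<Sum>p | p \<in> UNIV \<and> ?F p $ k \<noteq> 0. ?F p $ k)"
      by (rule sum.mono_neutral_right[OF finite_shapes]) (auto simp: nth split: if_splits)
    finally show ?thesis .
  qed
qed

end
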